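(* Let $(X,M,\ast)$ be a non-Archimedean fuzzy metric space in the sense of Kramosil and Michálek whose t-norm $\ast$ is continuous at the $1$-boundary. Then the fuzzy space $(X,M)$ satisfies the property $\mathcal{NC}$.
   Context: Notation: $\mathbb{I}=[0,1]$, $\mathbb{N}=\{1,2,\ldots\}$. A t-norm is a function $\ast:\mathbb{I}\times\mathbb{I}\to\mathbb{I}$ that is associative, commutative, nondecreasing in each argument and has $1$ as unity. It is continuous at the $1$-boundary if it is continuous at each point $(1,s)$, $s\in\mathbb{I}$ (that is, $t_n\to1$ and $s_n\to s$ imply $t_n\ast s_n\to s$). A fuzzy metric space in the sense of Kramosil and Michálek (KM-FMS) is a triple $(X,M,\ast)$ with $X$ a non-empty set, $\ast$ a t-norm and $M:X\times X\times[0,\infty)\to\mathbb{I}$ such that for all $x,y,z\in X$ and $t,s\ge0$: (1) $M(x,y,0)=0$; (2) $M(x,y,t)=1$ for all $t>0$ iff $x=y$; (3) $M(x,y,t)=M(y,x,t)$; (4) $M(x,z,t+s)\ge M(x,y,t)\ast M(y,z,s)$; (5) $M(x,y,\cdot):[0,\infty)\to[0,1]$ is left-continuous. It is non-Archimedean if $M(x,z,t)\ge M(x,y,t)\ast M(y,z,t)$ for all $x,y,z\in X$ and all $t>0$. A fuzzy space is a pair $(X,M)$ with $X$ non-empty and $M:X\times X\times[0,\infty)\to\mathbb{I}$ any function. A sequence $\{x_n\}\subseteq X$ is $M$-Cauchy if for all $\varepsilon\in(0,1)$ and $t>0$ there is $n_0\in\mathbb{N}$ such that $M(x_n,x_m,t)>1-\varepsilon$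 for all $n,m\ge n_0$. A fuzzy space $(X,M)$ satisfies the property $\mathcal{NC}$ if for each sequence $\{x_n\}\subseteq X$ which is not $M$-Cauchy and verifies $\lim_{n\to\infty}M(x_n,x_{n+1},t)=1$ for all $t>0$, there are $\varepsilon_0\in(0,1)$, $t_0>0$ and two subsequences $\{x_{n(k)}\}_{k\in\mathbb{N}}$, $\{x_{m(k)}\}_{k\in\mathbb{N}}$ of $\{x_n\}$ such that, for all $k\in\mathbb{N}$, $k<n(k)<m(k)<n(k+1)$ and $M(x_{n(k)},x_{m(k)-1},t_0)>1-\varepsilon_0\ge M(x_{n(k)},x_{m(k)},t_0)$, and also $\lim_{k\to\infty}M(x_{n(k)},x_{m(k)},t_0)=\lim_{k\to\infty}M(x_{n(k)-1},x_{m(k)-1},t_0)=1-\varepsilon_0$. *)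

theory Defs
  imports "HOL-Analysis.Analysis"
begin

text \<open>
  Functions on the unit interval, on a carrier set \<open>X\<close>, or on \<open>[0,\<infinity>)\<close> are total functions on
  the ambient types; every condition below is restricted to the intended domain, so values
  outside it are irrelevant.
\<close>

definition t_norm :: "(real \<Rightarrow> real \<Rightarrow> real) \<Rightarrow> bool" where
  "t_norm T \<longleftrightarrow>
     (\<forall>a\<in>{0..1}. \<forall>b\<in>{0..1}. T a b \<in> {0..1}) \<and>
     (\<forall>a\<in>{0..1}. \<forall>b\<in>{0..1}. \<forall>c\<in>{0..1}. T (T a b) c = T a (T b c)) \<and>
     (\<forall>a\<in>{0..1}. \<forall>b\<in>{0..1}. T a b = T b a) \<and>
     (\<forall>a\<in>{0..1}. mono_on {0..1} (\<lambda>b. T a b)) \<and>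
     (\<forall>b\<in>{0..1}. mono_on {0..1} (\<lambda>a. T a b)) \<and>
     (\<forall>a\<in>{0..1}. T a 1 = a \<and> T 1 a = a)"

definition continuous_at_one_boundary :: "(real \<Rightarrow> real \<Rightarrow> real) \<Rightarrow> bool" where
  "continuous_at_one_boundary T \<longleftrightarrow>
     (\<forall>s\<in>{0..1}. continuous (at (1, s) within {0..1} \<times> {0..1}) (\<lambda>(a, b). T a b))"

definition fuzzy_space :: "'a set \<Rightarrow> ('a \<Rightarrow> 'a \<Rightarrow> real \<Rightarrow> real) \<Rightarrow> bool" where
  "fuzzy_space X M \<longleftrightarrow> X \<noteq> {} \<and> (\<forall>x\<in>X. \<forall>y\<in>X. \<forall>t\<ge>0. M x y t \<in> {0..1})"

text \<open>
  Left-continuity on \<open>[0,\<infinity>)\<close> is continuity at each \<open>t\<close> within \<open>[0,t]\<close>; it is vacuous at \<open>t = 0\<close>.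
\<close>

definition KM_fuzzy_metric_space ::
  "'a set \<Rightarrow> ('a \<Rightarrow> 'a \<Rightarrow> real \<Rightarrow> real) \<Rightarrow> (real \<Rightarrow> real \<Rightarrow> real) \<Rightarrow> bool" where
  "KM_fuzzy_metric_space X M T \<longleftrightarrow>
     fuzzy_space X M \<and> t_norm T \<and>
     (\<forall>x\<in>X. \<forall>y\<in>X. M x y 0 = 0) \<and>
     (\<forall>x\<in>X. \<forall>y\<in>X. (\<forall>t>0. M x y t = 1) \<longleftrightarrow> x = y) \<and>
     (\<forall>x\<in>X. \<forall>y\<in>X. \<forall>t\<ge>0. M x y t = M y x t) \<and>
     (\<forall>x\<in>X. \<forall>y\<in>X. \<forall>z\<in>X. \<forall>t\<ge>0. \<forall>s\<ge>0. M x z (t + s) \<ge> T (M x y t) (M y z s)) \<and>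
     (\<forall>x\<in>X. \<forall>y\<in>X. \<forall>t\<ge>0. continuous (at t within {0..t}) (M x y))"

definition non_Archimedean ::
  "'a set \<Rightarrow> ('a \<Rightarrow> 'a \<Rightarrow> real \<Rightarrow> real) \<Rightarrow> (real \<Rightarrow> real \<Rightarrow> real) \<Rightarrow> bool" where
  "non_Archimedean X M T \<longleftrightarrow>
     (\<forall>x\<in>X. \<forall>y\<in>X. \<forall>z\<in>X. \<forall>t>0. M x z t \<ge> T (M x y t) (M y z t))"

definition M_Cauchy :: "('a \<Rightarrow> 'a \<Rightarrow> real \<Rightarrow> real) \<Rightarrow> (nat \<Rightarrow> 'a) \<Rightarrow> bool" where
  "M_Cauchy M x \<longleftrightarrow>
     (\<forall>\<epsilon>\<in>{0<..<1}. \<forall>t>0. \<exists>n0. \<forall>n\<ge>n0. \<forall>m\<ge>n0. M (x n) (x m) t > 1 - \<epsilon>)"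

text \<open>
  Sequences are indexed from \<open>0\<close>. Shifting all indices (both \<open>k\<close> and the values of \<open>n\<close> and \<open>m\<close>)
  by one carries the property below exactly to its version for sequences indexed by
  \<open>1, 2, \<dots>\<close>. Since \<open>n k > k \<ge> 0\<close>, the natural-number subtractions do not truncate.
\<close>

definition property_NC :: "'a set \<Rightarrow> ('a \<Rightarrow> 'a \<Rightarrow> real \<Rightarrow> real) \<Rightarrow> bool" where
  "property_NC X M \<longleftrightarrow>
     (\<forall>x :: nat \<Rightarrow> 'a.
        range x \<subseteq> X \<and> \<not> M_Cauchy M x \<and>
        (\<forall>t>0. (\<lambda>n. M (x n) (x (n + 1)) t) \<longlonglongrightarrow> 1) \<longrightarrow>
        (\<exists>\<epsilon>0\<in>{0<..<1}. \<exists>t0>0. \<exists>n m :: nat \<Rightarrow> nat.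
           strict_mono n \<and> strict_mono m \<and>
           (\<forall>k. k < n k \<and> n k < m k \<and> m k < n (k + 1) \<and>
                M (x (n k)) (x (m k - 1)) t0 > 1 - \<epsilon>0 \<and>
                1 - \<epsilon>0 \<ge> M (x (n k)) (x (m k)) t0) \<and>
           (\<lambda>k. M (x (n k)) (x (m k)) t0) \<longlonglongrightarrow> 1 - \<epsilon>0 \<and>
           (\<lambda>k. M (x (n k - 1)) (x (m k - 1)) t0) \<longlonglongrightarrow> 1 - \<epsilon>0))"

end

theory Submission
  imports Defs
begin

text \<open>
  If the sequence \<open>x\<close> is not Cauchy, there are a level \<open>c = 1 - \<epsilon>\<close> and a scale \<open>t\<close> such that
  \<open>M (x p) (x q) t \<le> c\<close> for arbitrarily late \<open>p < q\<close>. Take such \<open>p = n k\<close> and let \<open>m k\<close> be the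
  least \<open>q > n k\<close> with this property. The non-Archimedean inequality keeps the scale \<open>t\<close> fixed, so
  moving an index by one changes the value only by a factor (with respect to the t-norm)
  that tends to \<open>1\<close>; continuity at the \<open>1\<close>-boundary makes this factor disappear in the limit.
\<close>

text \<open>Sequential continuity at \<open>(1, s)\<close> within the unit square, combined with
  \<open>T 1 s = s\<close>: a first factor tending to 1 leaves no trace in the limit.\<close>

lemma continuous_at_one_boundary_tendsto:
  assumes "t_norm T" "continuous_at_one_boundary T"
    and "\<And>k. u k \<in> {0..1}" "\<And>k. w k \<in> {0..1}" "s \<in> {0..1}"
    and "u \<longlonglongrightarrow> 1" "w \<longlonglongrightarrow> s"
  shows "(\<lambda>k. T (u k) (w k)) \<longlonglongrightarrow> s"
proof -
  have cont: "continuous (at (1, s) within {0..1} \<times> {0..1}) (\<lambda>(a, b). T a b)"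
    using assms(2,5) by (auto simp: continuous_at_one_boundary_def)
  have "(\<lambda>k. (u k, w k)) \<longlonglongrightarrow> (1, s)"
    using assms(6,7) by (rule tendsto_Pair)
  then have "((\<lambda>(a, b). T a b) \<circ> (\<lambda>k. (u k, w k))) \<longlonglongrightarrow> (\<lambda>(a, b). T a b) (1, s)"
    using cont assms(3,4) unfolding continuous_within_sequentially by (simp add: mem_Times_iff)
  moreover have "T 1 s = s"
    using assms(1,5) unfolding t_norm_def by blast
  ultimately show ?thesis by (simp add: comp_def)
qed

lemma t_norm_mono:
  assumes "t_norm T" "a \<in> {0..1}" "b \<in> {0..1}" "a' \<in> {0..1}" "b' \<in> {0..1}" "a \<le> a'" "b \<le> b'"
  shows "T a b \<le> T a' b'"
proof -
  have mono: "mono_on {0..1} (\<lambda>a. T a b)" "mono_on {0..1} (T a')"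
    using assms(1,3,4) unfolding t_norm_def by blast+
  have "T a b \<le> T a' b"
    using mono_onD[OF mono(1)] assms by blast
  also have "\<dots> \<le> T a' b'"
    using mono_onD[OF mono(2)] assms by blast
  finally show ?thesis .
qed

text \<open>
  The two limits of property \<open>\<N>\<C>\<close>, for a function \<open>a\<close> of pairs of indices standing for
  \<open>\<lambda>i j. M (x i) (x j) t\<close>.
\<close>

lemma limits_at_first_crossing:
  fixes a :: "nat \<Rightarrow> nat \<Rightarrow> real" and n m :: "nat \<Rightarrow> nat"
  assumes T: "t_norm T" and cont: "continuous_at_one_boundary T"
    and range: "\<And>i j. a i j \<in> {0..1}"
    and sym: "\<And>i j. a i j = a j i"
    and tri: "\<And>i j k. a i k \<ge> T (a i j) (a j k)"
    and step: "(\<lambda>i. a i (i + 1)) \<longlonglongrightarrow> 1"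
    and c: "c \<in> {0..1}"
    and n: "strict_mono n" "\<And>k. 0 < n k" and m: "strict_mono m" "\<And>k. 0 < m k"
    and above: "\<And>k. a (n k) (m k - 1) > c" and below: "\<And>k. a (n k) (m k) \<le> c"
  shows "(\<lambda>k. a (n k) (m k)) \<longlonglongrightarrow> c" and "(\<lambda>k. a (n k - 1) (m k - 1)) \<longlonglongrightarrow> c"
proof -
  define u where "u = (\<lambda>k. a (n k - 1) (n k))"
  define v where "v = (\<lambda>k. a (m k - 1) (m k))"
  define b where "b = (\<lambda>k. a (n k - 1) (m k - 1))"
  have comm: "T p q = T q p" if "p \<in> {0..1}" "q \<in> {0..1}" for p q
    using T that unfolding t_norm_def by blast
  have closed: "T p q \<in> {0..1}" if "p \<in> {0..1}" "q \<in> {0..1}" for p q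
    using T that unfolding t_norm_def by blast
  have shift: "(\<lambda>k. a (f k - 1) (f k)) \<longlonglongrightarrow> 1" if "strict_mono f" "\<And>k. 0 < f k" for f :: "nat \<Rightarrow> nat"
  proof -
    have "(\<lambda>i. a (i - 1) i) \<longlonglongrightarrow> 1"
      using step by (subst filterlim_sequentially_Suc[symmetric]) simp
    from LIMSEQ_subseq_LIMSEQ[OF this that(1)] show ?thesis by (simp add: comp_def)
  qed
  have u: "u \<longlonglongrightarrow> 1" "u k \<in> {0..1}" for k
    unfolding u_def using shift n range by auto
  have v: "v \<longlonglongrightarrow> 1" "v k \<in> {0..1}" for k
    unfolding v_def using shift m range by auto
  have b: "b k \<in> {0..1}" for k
    unfolding b_def using range by auto
  note lim = continuous_at_one_boundary_tendsto[OF T cont]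

  show "(\<lambda>k. a (n k) (m k)) \<longlonglongrightarrow> c"
  \<comment> \<open>The upper bound is the crossing itself. The lower bound goes from
    \<open>n k\<close> to \<open>m k\<close> through \<open>m k - 1\<close>, where the value still
    exceeds \<open>c\<close>.\<close>
  proof (rule tendsto_sandwich[OF _ _ _ tendsto_const])
    show "(\<lambda>k. T (v k) c) \<longlonglongrightarrow> c"
      using v c by (intro lim) auto
    have "T (v k) c \<le> a (n k) (m k)" for k
    proof -
      have "T (v k) c \<le> T (v k) (a (n k) (m k - 1))"
        using above[of k] by (intro t_norm_mono[OF T] v c range) auto
      also have "\<dots> = T (a (n k) (m k - 1)) (v k)"
        using range v by (intro comm)
      also have "\<dots> \<le> a (n k) (m k)"
        unfolding v_def by (rule tri)
      finally show ?thesis .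
    qed
    then show "\<forall>\<^sub>F k in sequentially. T (v k) c \<le> a (n k) (m k)" by simp
    show "\<forall>\<^sub>F k in sequentially. a (n k) (m k) \<le> c" using below by simp
  qed

  have "b \<longlonglongrightarrow> c"
  \<comment> \<open>The value \<open>b k\<close> may lie on either side of \<open>c\<close>, so
    there is no constant upper bound to sandwich with. The lower half passes through
    \<open>n k\<close>; the upper half is by contradiction.\<close>
  proof (rule order_tendstoI)
    fix y assume "y < c"
    have "(\<lambda>k. T (u k) c) \<longlonglongrightarrow> c"
      using u c by (intro lim) auto
    then have "\<forall>\<^sub>F k in sequentially. y < T (u k) c"
      using \<open>y < c\<close> by (rule order_tendstoD)
    moreover have "T (u k) c \<le> b k" for k
    proof -
      have "T (u k) c \<le> T (u k) (a (n k) (m k - 1))"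
        using above[of k] by (intro t_norm_mono[OF T] u c range) auto
      also have "\<dots> \<le> b k"
        unfolding u_def b_def by (rule tri)
      finally show ?thesis .
    qed
    ultimately show "\<forall>\<^sub>F k in sequentially. y < b k"
      by (auto elim!: eventually_mono intro: less_le_trans)
  next
    fix y assume "c < y"
    show "\<forall>\<^sub>F k in sequentially. b k < y"
    \<comment> \<open>The t-norm is controlled only on the unit interval; levels above 1 are trivial
      because \<open>b k \<le> 1\<close>.\<close>
    proof (cases "y \<le> 1")
      case True
      with \<open>c < y\<close> c have y: "y \<in> {0..1}" by auto
      \<comment> \<open>This is the lower bound for \<open>a (n k) (m k)\<close> along the path
        \<open>n k\<close>, \<open>n k - 1\<close>, \<open>m k - 1\<close>, \<open>m k\<close> if
        \<open>b k \<ge> y\<close>. Once it exceeds \<open>c\<close>, it contradicts the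
        crossing.\<close>
      have "(\<lambda>k. T (v k) (T (u k) y)) \<longlonglongrightarrow> y"
        using u v y by (intro lim closed) auto
      then have "\<forall>\<^sub>F k in sequentially. c < T (v k) (T (u k) y)"
        using \<open>c < y\<close> by (rule order_tendstoD)
      moreover have "b k < y" if "c < T (v k) (T (u k) y)" for k
      proof (rule ccontr)
        assume "\<not> b k < y"
        then have "T (u k) y \<le> T (u k) (b k)"
          by (intro t_norm_mono[OF T] u b y) auto
        also have "\<dots> \<le> a (n k) (m k - 1)"
          using tri[of "n k" "n k - 1" "m k - 1"] sym[of "n k" "n k - 1"]
          by (simp add: u_def b_def)
        finally have "T (v k) (T (u k) y) \<le> T (v k) (a (n k) (m k - 1))"
          by (intro t_norm_mono[OF T] closed u v y range) auto
        also have "\<dots> = T (a (n k) (m k - 1)) (v k)"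
          using range v by (intro comm)
        also have "\<dots> \<le> a (n k) (m k)"
          unfolding v_def by (rule tri)
        also have "\<dots> \<le> c" by (rule below)
        finally show False using that by simp
      qed
      ultimately show ?thesis by (auto elim!: eventually_mono)
    next
      case False
      then have "b k < y" for k
        using b[of k] by auto
      then show ?thesis by simp
    qed
  qed
  then show "(\<lambda>k. a (n k - 1) (m k - 1)) \<longlonglongrightarrow> c" by (simp add: b_def)
qed

text \<open>For fixed \<open>p\<close>, the value starts above \<open>c\<close> at
  \<open>q = p\<close> and is at most \<open>c\<close> for some later \<open>q\<close>; the least
  such \<open>q\<close> is the crossing. Starting each search beyond the previous pair separates the
  pairs.\<close>

lemma first_crossing_subsequences:
  fixes a :: "nat \<Rightarrow> nat \<Rightarrow> real"
  assumes diag: "\<And>i. a i i > c" and late: "\<And>N. \<exists>p\<ge>N. \<exists>q>p. a p q \<le> c"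
  obtains n m :: "nat \<Rightarrow> nat" where "\<And>k. k < n k" "\<And>k. n k < m k" "\<And>k. m k < n (k + 1)"
    "\<And>k. a (n k) (m k - 1) > c" "\<And>k. a (n k) (m k) \<le> c"
proof -
  let ?P = "\<lambda>k (p, q). k < p \<and> p < q \<and> a p (q - 1) > c \<and> a p q \<le> c"
  have crossing: "\<exists>p q. N < p \<and> p < q \<and> a p (q - 1) > c \<and> a p q \<le> c" for N
  proof -
    obtain p q where pq: "Suc N \<le> p" "p < q" "a p q \<le> c"
      using late by blast
    define q' where "q' = (LEAST q. p < q \<and> a p q \<le> c)"
    have q': "p < q'" "a p q' \<le> c"
      using LeastI[of "\<lambda>q. p < q \<and> a p q \<le> c" q] pq by (auto simp: q'_def)
    \<comment> \<open>Minimality of \<open>q'\<close> speaks only about indices beyond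
      \<open>p\<close>; if \<open>q' - 1 = p\<close>, the diagonal hypothesis takes over.\<close>
    have "a p (q' - 1) > c"
    proof (cases "p < q' - 1")
      case True
      with not_less_Least[of "q' - 1" "\<lambda>q. p < q \<and> a p q \<le> c"] show ?thesis
        by (auto simp: q'_def[symmetric])
    next
      case False
      with q'(1) have "q' - 1 = p" by simp
      then show ?thesis by (simp add: diag)
    qed
    with pq q' show ?thesis by (intro exI[of _ p] exI[of _ q']) auto
  qed
  have "\<exists>f. \<forall>k. ?P k (f k) \<and> snd (f k) < fst (f (Suc k))"
  proof (rule dependent_nat_choice)
    show "\<exists>r. ?P 0 r"
      using crossing[of 0] by auto
  next
    fix r :: "nat \<times> nat" and k assume "?P k r"
    \<comment> \<open>Searching beyond \<open>snd r\<close> also yields \<open>Suc k < p\<close>,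
      since \<open>k < fst r < snd r\<close>.\<close>
    moreover obtain p q where "snd r < p" "p < q" "a p (q - 1) > c" "a p q \<le> c"
      using crossing by blast
    ultimately show "\<exists>r'. ?P (Suc k) r' \<and> snd r < fst r'"
      by (intro exI[of _ "(p, q)"]) auto
  qed
  then obtain f where "\<forall>k. ?P k (f k) \<and> snd (f k) < fst (f (Suc k))" ..
  then show thesis
    by (intro that[of "fst \<circ> f" "snd \<circ> f"]) (auto simp: case_prod_unfold)
qed

theorem theorem22:
  fixes X :: "'a set" and M :: "'a \<Rightarrow> 'a \<Rightarrow> real \<Rightarrow> real" and T :: "real \<Rightarrow> real \<Rightarrow> real"
  assumes "KM_fuzzy_metric_space X M T"
    and "non_Archimedean X M T"
    and "continuous_at_one_boundary T"
  shows "property_NC X M"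
  unfolding property_NC_def
proof (intro allI impI, elim conjE)
  fix x :: "nat \<Rightarrow> 'a"
  assume "range x \<subseteq> X" and not_Cauchy: "\<not> M_Cauchy M x"
    and step: "\<forall>t>0. (\<lambda>n. M (x n) (x (n + 1)) t) \<longlonglongrightarrow> 1"
  then have X: "x i \<in> X" for i by auto
  \<comment> \<open>The pair witnessing the failure of the Cauchy condition serves unchanged as
    \<open>\<epsilon>0\<close> and \<open>t0\<close>.\<close>
  obtain \<epsilon> t where \<epsilon>: "\<epsilon> \<in> {0<..<1}" and t: "t > 0"
    and far: "\<And>N. \<exists>p\<ge>N. \<exists>q\<ge>N. M (x p) (x q) t \<le> 1 - \<epsilon>"
    using not_Cauchy unfolding M_Cauchy_def by (meson not_le)
  define a where "a = (\<lambda>i j. M (x i) (x j) t)"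
  note KM = assms(1)[unfolded KM_fuzzy_metric_space_def fuzzy_space_def]
  have T: "t_norm T"
    using KM by blast
  have "\<forall>x\<in>X. \<forall>y\<in>X. \<forall>t\<ge>0. M x y t \<in> {0..1}"
    using KM by (elim conjE)
  then have range: "a i j \<in> {0..1}" for i j
    using X less_imp_le[OF t] unfolding a_def by blast
  have "\<forall>x\<in>X. \<forall>y\<in>X. \<forall>t\<ge>0. M x y t = M y x t"
    using KM by (elim conjE)
  then have sym: "a i j = a j i" for i j
    using X less_imp_le[OF t] unfolding a_def by metis
  have "\<forall>x\<in>X. \<forall>y\<in>X. (\<forall>t>0. M x y t = 1) \<longleftrightarrow> x = y"
    using KM by (elim conjE)
  then have diag: "a i i = 1" for i
    using X[of i] t unfolding a_def by metis
  have tri: "a i k \<ge> T (a i j) (a j k)" for i j k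
    using assms(2) X t unfolding non_Archimedean_def a_def by blast
  \<comment> \<open>The indices given by \<open>far\<close> are unordered: the diagonal value 1
    rules out equality, and symmetry allows swapping them.\<close>
  have "\<exists>p\<ge>N. \<exists>q>p. a p q \<le> 1 - \<epsilon>" for N
  proof -
    obtain p q where pq: "p \<ge> N" "q \<ge> N" "a p q \<le> 1 - \<epsilon>"
      using far unfolding a_def by blast
    then have "p \<noteq> q" using diag[of p] \<epsilon> by auto
    then show ?thesis
      using pq sym[of p q] by (metis nat_neq_iff)
  qed
  moreover have "a i i > 1 - \<epsilon>" for i
    using diag \<epsilon> by simp
  ultimately obtain n m :: "nat \<Rightarrow> nat" where nm: "\<And>k. k < n k" "\<And>k. n k < m k" "\<And>k. m k < n (k + 1)"
    and cross: "\<And>k. a (n k) (m k - 1) > 1 - \<epsilon>" "\<And>k. a (n k) (m k) \<le> 1 - \<epsilon>"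
    using first_crossing_subsequences[of "1 - \<epsilon>" a] by blast
  have mono: "strict_mono n" "strict_mono m"
    using nm by (auto simp: strict_mono_Suc_iff intro: less_trans)
  have pos: "0 < n k" "0 < m k" for k
    using nm(1,2)[of k] by auto
  have "(\<lambda>i. a i (i + 1)) \<longlonglongrightarrow> 1" "1 - \<epsilon> \<in> {0..1}"
    using step t \<epsilon> by (auto simp: a_def)
  from limits_at_first_crossing[OF T assms(3) range sym tri this mono(1) pos(1) mono(2) pos(2) cross]
  show "\<exists>\<epsilon>0\<in>{0<..<1}. \<exists>t0>0. \<exists>n m :: nat \<Rightarrow> nat.
           strict_mono n \<and> strict_mono m \<and>
           (\<forall>k. k < n k \<and> n k < m k \<and> m k < n (k + 1) \<and>
                M (x (n k)) (x (m k - 1)) t0 > 1 - \<epsilon>0 \<and>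
                1 - \<epsilon>0 \<ge> M (x (n k)) (x (m k)) t0) \<and>
           (\<lambda>k. M (x (n k)) (x (m k)) t0) \<longlonglongrightarrow> 1 - \<epsilon>0 \<and>
           (\<lambda>k. M (x (n k - 1)) (x (m k - 1)) t0) \<longlonglongrightarrow> 1 - \<epsilon>0"
    using \<epsilon> t mono nm cross unfolding a_def by blast
qed

end
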